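(* Let $\ell\ge 1$ and $k\ge 2$ be integers with $(\ell,k)\neq(1,2)$. For each $i\in[k]=\{0,1,\ldots,k-1\}$, the set $S_i^k=\{v=v_0v_1\cdots v_{k\ell-1}\in V^\ell_k : v_0=i\}$ is an E$^\ell$-set of the graph $ST^\ell_k$; that is, every vertex $v\in V^\ell_k\setminus S_i^k$ has exactly $\ell$ neighbors in $S_i^k$. In particular, the graphs $ST^\ell_k$ form an E$^\ell$-chain.
   Context: For integers $\ell\ge1$, $k\ge2$, an $\ell$-set permutation is a string over the alphabet $[k]=\{0,\ldots,k-1\}$ containing exactly $\ell$ occurrences of each $i\in[k]$; $V^\ell_k$ denotes the set of all such strings (of length $k\ell$), i.e. all rearrangements of $0^\ell1^\ell\cdots(k-1)^\ell$. The star $\ell$-set transposition graph $ST^\ell_k$ has vertex set $V^\ell_k$, with $v=v_0\cdots v_{k\ell-1}$ adjacent to $w$ iff $w$ is obtained from $v$ by swapping the first entry $v_0$ with some entry $v_j$ ($1\le j\le k\ell-1$) such that $v_j\neq v_0$. For a graph $G$ and integer $\ell\ge1$, a set $S\subseteq V(G)$ is an efficient dominating$^\ell$-set (E$^\ell$-set) if every vertex of $V(G)\setminus S$ is adjacent to exactly $\ell$ vertices of $S$. An E$^\ell$-chain is a countable family of nested graphs each of which has an E$^\ell$-set. *)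

theory Defs
  imports "Graph_Theory.Graph_Theory"
begin

definition set_perms :: "nat \<Rightarrow> nat \<Rightarrow> nat list set" where
  "set_perms l k = {v. set v \<subseteq> {..<k} \<and> (\<forall>i<k. count_list v i = l)}"

definition star_graph :: "nat \<Rightarrow> nat \<Rightarrow> nat list pair_pre_digraph" where
  "star_graph l k =
     \<lparr> pverts = set_perms l k,
       parcs = {(v, w). v \<in> set_perms l k \<and> w \<in> set_perms l k \<and>
                  (\<exists>j. 1 \<le> j \<and> j \<le> k * l - 1 \<and> v ! j \<noteq> v ! 0 \<and>
                       w = v[0 := v ! j, j := v ! 0])} \<rparr>"

definition first_entry_set :: "nat \<Rightarrow> nat \<Rightarrow> nat \<Rightarrow> nat list set" where
  "first_entry_set l k i = {v \<in> set_perms l k. v ! 0 = i}"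

definition E_set :: "nat \<Rightarrow> ('a, 'b) pre_digraph \<Rightarrow> 'a set \<Rightarrow> bool" where
  "E_set l G S \<longleftrightarrow>
     S \<subseteq> verts G \<and> (\<forall>v \<in> verts G - S. card {w \<in> S. v \<rightarrow>\<^bsub>G\<^esub> w} = l)"

text \<open>Graphs with different vertex sets of strings are nested along embeddings:
  each member of the family is isomorphic to an induced subgraph of every later one.
  For a family indexed by a set of natural numbers this is equivalent to requiring it for
  consecutive members only, since embeddings compose.\<close>

definition E_chain :: "nat \<Rightarrow> nat set \<Rightarrow> (nat \<Rightarrow> ('a, 'b) pre_digraph) \<Rightarrow> bool" where
  "E_chain l K G \<longleftrightarrow>
     (\<forall>k \<in> K. graph (G k) \<and> (\<exists>S. E_set l (G k) S)) \<and>
     (\<forall>j \<in> K. \<forall>k \<in> K. j < k \<longrightarrow>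
        (\<exists>H. induced_subgraph H (G k) \<and> digraph_iso (G j) H))"

end

theory Submission
  imports Defs "HOL-Combinatorics.Multiset_Permutations"
begin

text \<open>A neighbour of \<open>v\<close> with first entry \<open>i \<noteq> v\<^sub>0\<close> is determined by the position of the entry \<open>i\<close>
  that is brought to the front, and there are exactly \<open>\<ell>\<close> such positions. For \<open>j < k\<close>, the graph on
  the alphabet \<open>[j]\<close> embeds into the graph on \<open>[k]\<close> by appending a fixed arrangement of
  \<open>j\<^sup>\<ell> \<dots> (k-1)\<^sup>\<ell>\<close>. The image is induced because a swap that involves a position of the appended word
  changes that word. Both arguments apply to the rearrangements of an arbitrary finite multiset of
  letters.\<close>

subsection \<open>Star transpositions of words\<close>

definition swap_first :: "'a list \<Rightarrow> nat \<Rightarrow> 'a list" where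
  "swap_first v p = v[0 := v ! p, p := v ! 0]"

lemma length_swap_first [simp]: "length (swap_first v p) = length v"
  by (simp add: swap_first_def)

lemma mset_swap_first: "p < length v \<Longrightarrow> mset (swap_first v p) = mset v"
  unfolding swap_first_def by (rule mset_swap) auto

lemma nth_swap_first:
  assumes "p < length v" "q < length v"
  shows "swap_first v p ! q = (if q = p then v ! 0 else if q = 0 then v ! p else v ! q)"
  using assms by (auto simp: swap_first_def nth_list_update)

lemma swap_first_nth_0 [simp]: "p < length v \<Longrightarrow> swap_first v p ! 0 = v ! p"
  by (cases v; cases p) (auto simp: swap_first_def)

lemma swap_first_swap_first [simp]: "p < length v \<Longrightarrow> swap_first (swap_first v p) p = v"
  by (rule nth_equalityI) (auto simp: nth_swap_first)

lemma swap_first_append: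
  "p < length v \<Longrightarrow> swap_first (v @ s) p = swap_first v p @ s"
  by (auto simp: swap_first_def list_update_append nth_append)

lemma inj_on_swap_first:
  assumes "v ! 0 \<noteq> i"
  shows "inj_on (swap_first v) {p. p < length v \<and> v ! p = i}"
proof (rule inj_onI, rule ccontr)
  fix p q
  assume p: "p \<in> {p. p < length v \<and> v ! p = i}" and q: "q \<in> {p. p < length v \<and> v ! p = i}"
    and eq: "swap_first v p = swap_first v q" and "p \<noteq> q"
  have "v ! 0 = swap_first v p ! p"
    using p by (simp add: nth_swap_first)
  also have "\<dots> = swap_first v q ! p"
    by (simp add: eq)
  also have "\<dots> = i"
    using p q \<open>p \<noteq> q\<close> by (auto simp: nth_swap_first)
  finally show False
    using assms by simp
qed

definition star_adjacent :: "'a list \<Rightarrow> 'a list \<Rightarrow> bool" where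
  "star_adjacent v w \<longleftrightarrow> (\<exists>p<length v. v ! p \<noteq> v ! 0 \<and> w = swap_first v p)"

lemma star_adjacent_mset_eq: "star_adjacent v w \<Longrightarrow> mset w = mset v"
  by (auto simp: star_adjacent_def mset_swap_first)

lemma star_adjacent_nth_0_neq: "star_adjacent v w \<Longrightarrow> w ! 0 \<noteq> v ! 0"
  by (auto simp: star_adjacent_def)

lemma star_adjacent_sym:
  assumes "star_adjacent v w"
  shows "star_adjacent w v"
proof -
  obtain p where "p < length v" "v ! p \<noteq> v ! 0" "w = swap_first v p"
    using assms by (auto simp: star_adjacent_def)
  then show ?thesis
    by (auto simp: star_adjacent_def nth_swap_first intro!: exI[of _ p])
qed

lemma star_adjacent_append_iff:
  "star_adjacent (v @ s) (w @ s) \<longleftrightarrow> star_adjacent v w"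
proof
  assume "star_adjacent (v @ s) (w @ s)"
  then obtain p where p: "p < length (v @ s)" "(v @ s) ! p \<noteq> (v @ s) ! 0"
    and eq: "w @ s = swap_first (v @ s) p"
    by (auto simp: star_adjacent_def)
  have "length (w @ s) = length (v @ s)"
    using eq by simp
  then have len: "length w = length v"
    by simp
  have "p < length v"
  proof (rule ccontr)
    assume "\<not> p < length v"
    then have "(v @ s) ! p = (w @ s) ! p"
      by (simp add: nth_append len)
    also have "\<dots> = (v @ s) ! 0"
      unfolding eq using p(1) by (simp add: nth_swap_first)
    finally show False
      using p(2) by contradiction
  qed
  moreover have "v ! p \<noteq> v ! 0"
    using p(2) \<open>p < length v\<close> by (cases "v = []") (auto simp: nth_append)
  moreover have "w = swap_first v p"
    using eq \<open>p < length v\<close> by (simp add: swap_first_append)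
  ultimately show "star_adjacent v w"
    by (auto simp: star_adjacent_def)
next
  assume "star_adjacent v w"
  then obtain p where "p < length v" "v ! p \<noteq> v ! 0" "w = swap_first v p"
    by (auto simp: star_adjacent_def)
  then show "star_adjacent (v @ s) (w @ s)"
    by (auto simp: star_adjacent_def swap_first_append nth_append intro!: exI[of _ p])
qed

lemma card_star_adjacent_nth_0:
  assumes "v ! 0 \<noteq> i"
  shows "card {w. star_adjacent v w \<and> w ! 0 = i} = count (mset v) i"
proof -
  let ?P = "{p. p < length v \<and> v ! p = i}"
  have "{w. star_adjacent v w \<and> w ! 0 = i} = swap_first v ` ?P"
    using assms by (auto simp: star_adjacent_def)
  then have "card {w. star_adjacent v w \<and> w ! 0 = i} = card ?P"
    by (simp add: card_image[OF inj_on_swap_first[OF assms]])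
  also have "\<dots> = count (mset v) i"
    by (simp add: count_mset count_list_eq_length_filter length_filter_conv_card eq_commute)
  finally show ?thesis .
qed

subsection \<open>Induced embeddings of digraphs without parallel arcs\<close>

definition induced_embedding ::
    "('a \<Rightarrow> 'b) \<Rightarrow> 'a pair_pre_digraph \<Rightarrow> 'b pair_pre_digraph \<Rightarrow> bool" where
  "induced_embedding f G H \<longleftrightarrow>
     inj_on f (pverts G) \<and> f ` pverts G \<subseteq> pverts H \<and>
     (\<forall>u \<in> pverts G. \<forall>v \<in> pverts G. (f u, f v) \<in> parcs H \<longleftrightarrow> (u, v) \<in> parcs G)"

lemma induced_embedding_imp_iso_induced_subgraph:
  assumes "pair_wf_digraph G" "pair_wf_digraph H" "induced_embedding f G H"
  shows "\<exists>K. induced_subgraph K (with_proj H) \<and> digraph_iso (with_proj G) K"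
proof -
  interpret G: pair_wf_digraph G by fact
  interpret H: pair_wf_digraph H by fact
  let ?K = "with_proj H \<restriction> (f ` pverts G)"
  define h where
    "h = \<lparr>iso_verts = f, iso_arcs = map_prod f f, iso_head = snd, iso_tail = fst\<rparr>"
  have inj: "inj_on f (pverts G)" and verts: "f ` pverts G \<subseteq> pverts H"
    and arcs: "\<forall>u \<in> pverts G. \<forall>v \<in> pverts G. (f u, f v) \<in> parcs H \<longleftrightarrow> (u, v) \<in> parcs G"
    using assms(3) by (auto simp: induced_embedding_def)
  have parcs_subset: "parcs G \<subseteq> pverts G \<times> pverts G"
    by (auto dest: G.in_arcsD1 G.in_arcsD2)
  have "inj_on (map_prod f f) (parcs G)"
    using map_prod_inj_on[OF inj inj] parcs_subset by (rule inj_on_subset)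
  then have "G.digraph_isomorphism h"
    using inj G.wf_digraph by (auto simp: G.digraph_isomorphism_def h_def)
  moreover have "map_prod f f ` parcs G = arcs ?K"
  proof
    show "map_prod f f ` parcs G \<subseteq> arcs ?K"
      using parcs_subset arcs by auto
    show "arcs ?K \<subseteq> map_prod f f ` parcs G"
      using arcs by (auto intro!: rev_image_eqI)
  qed
  then have "?K = app_iso h (with_proj G)"
    by (simp add: app_iso_def h_def induce_subgraph_def)
  ultimately have "digraph_iso (with_proj G) ?K"
    by (auto simp: digraph_iso_def)
  moreover have "induced_subgraph ?K (with_proj H)"
    using verts by (rule H.induced_induce)
  ultimately show ?thesis
    by blast
qed

subsection \<open>The star transposition graph of a multiset\<close>

definition star_transposition_graph :: "'a multiset \<Rightarrow> 'a list pair_pre_digraph" where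
  "star_transposition_graph A =
     \<lparr> pverts = permutations_of_multiset A,
       parcs = {(v, w). v \<in> permutations_of_multiset A \<and> star_adjacent v w} \<rparr>"

lemma pverts_star_transposition_graph [simp]:
  "pverts (star_transposition_graph A) = permutations_of_multiset A"
  by (simp add: star_transposition_graph_def)

lemma parcs_star_transposition_graph_iff [simp]:
  "(v, w) \<in> parcs (star_transposition_graph A) \<longleftrightarrow>
     v \<in> permutations_of_multiset A \<and> star_adjacent v w"
  by (simp add: star_transposition_graph_def)

lemma star_adjacent_in_permutations_of_multiset:
  "v \<in> permutations_of_multiset A \<Longrightarrow> star_adjacent v w \<Longrightarrow> w \<in> permutations_of_multiset A"
  by (simp add: permutations_of_multiset_def star_adjacent_mset_eq)

lemma pair_graph_star_transposition_graph: "pair_graph (star_transposition_graph A)"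
proof -
  let ?G = "star_transposition_graph A"
  have subset: "parcs ?G \<subseteq> permutations_of_multiset A \<times> permutations_of_multiset A"
    by (auto intro: star_adjacent_in_permutations_of_multiset)
  then have "finite (parcs ?G)"
    by (rule finite_subset) simp
  moreover have "symmetric (with_proj ?G)"
    by (auto simp: symmetric_def
        intro!: symI intro: star_adjacent_sym star_adjacent_in_permutations_of_multiset)
  moreover have "fst e \<noteq> snd e" if "e \<in> parcs ?G" for e
    using that by (cases e) (auto dest: star_adjacent_nth_0_neq)
  ultimately show ?thesis
    using subset by unfold_locales auto
qed

lemma E_set_star_transposition_graph:
  "E_set (count A i) (with_proj (star_transposition_graph A))
     {v \<in> permutations_of_multiset A. v ! 0 = i}"
  (is "E_set _ ?G ?S")
  unfolding E_set_def
proof (intro conjI ballI)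
  show "?S \<subseteq> verts ?G"
    by auto
next
  fix v
  assume "v \<in> verts ?G - ?S"
  then have v: "v \<in> permutations_of_multiset A" "v ! 0 \<noteq> i"
    by auto
  then have "{w \<in> ?S. v \<rightarrow>\<^bsub>?G\<^esub> w} = {w. star_adjacent v w \<and> w ! 0 = i}"
    by (auto intro: star_adjacent_in_permutations_of_multiset)
  then show "card {w \<in> ?S. v \<rightarrow>\<^bsub>?G\<^esub> w} = count A i"
    using v by (simp add: card_star_adjacent_nth_0 permutations_of_multisetD)
qed

lemma induced_embedding_append:
  "induced_embedding (\<lambda>v. v @ s)
     (star_transposition_graph A) (star_transposition_graph (A + mset s))"
  by (auto simp: induced_embedding_def inj_on_def permutations_of_multiset_def
      star_adjacent_append_iff)

subsection \<open>Star \<open>\<ell>\<close>-set transposition graphs\<close>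

lemma set_perms_eq_permutations_of_multiset:
  "set_perms l k = permutations_of_multiset (repeat_mset l (mset_set {..<k}))"
proof -
  have "set v \<subseteq> {..<k} \<and> (\<forall>i<k. count_list v i = l) \<longleftrightarrow>
      (\<forall>i. count_list v i = (if i < k then l else 0))" for v
    by (auto simp: count_list_0_iff subset_iff)
  then show ?thesis
    by (simp add: set_perms_def permutations_of_multiset_def multiset_eq_iff count_mset
        count_mset_set' if_distrib cong: if_cong)
qed

lemma star_graph_eq_star_transposition_graph:
  "star_graph l k = star_transposition_graph (repeat_mset l (mset_set {..<k}))"
proof -
  let ?V = "permutations_of_multiset (repeat_mset l (mset_set {..<k}))"
  have "w \<in> ?V \<and> (\<exists>p. 1 \<le> p \<and> p \<le> k * l - 1 \<and> v ! p \<noteq> v ! 0 \<and> w = v[0 := v ! p, p := v ! 0])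
      \<longleftrightarrow> star_adjacent v w" if v: "v \<in> ?V" for v w
  proof -
    have "length v = k * l"
      using length_finite_permutations_of_multiset[OF v] by (simp add: mult.commute)
    then have "1 \<le> p \<and> p \<le> k * l - 1 \<and> v ! p \<noteq> v ! 0 \<longleftrightarrow> p < length v \<and> v ! p \<noteq> v ! 0" for p
      by (cases p) auto
    then show ?thesis
      using star_adjacent_in_permutations_of_multiset[OF v]
      by (auto simp: star_adjacent_def swap_first_def)
  qed
  then show ?thesis
    by (auto simp: star_graph_def star_transposition_graph_def set_perms_eq_permutations_of_multiset)
qed

lemma E_set_first_entry_set:
  assumes "i < k"
  shows "E_set l (with_proj (star_graph l k)) (first_entry_set l k i)"
  using E_set_star_transposition_graph[of "repeat_mset l (mset_set {..<k})" i] assms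
  by (simp add: star_graph_eq_star_transposition_graph first_entry_set_def
      set_perms_eq_permutations_of_multiset)

lemma star_graph_iso_induced_subgraph:
  assumes "j \<le> k"
  shows "\<exists>H. induced_subgraph H (with_proj (star_graph l k)) \<and>
    digraph_iso (with_proj (star_graph l j)) H"
proof -
  have split: "repeat_mset l (mset_set {..<k}) =
      repeat_mset l (mset_set {..<j}) + repeat_mset l (mset_set {j..<k})"
    using mset_set_Union[of "{..<j}" "{j..<k}"]
    by (simp add: ivl_disj_int_one ivl_disj_un_one(2)[OF assms])
  obtain s where s: "mset s = repeat_mset l (mset_set {j..<k})"
    using ex_mset by blast
  have "pair_wf_digraph (star_graph l m)" for m
    unfolding star_graph_eq_star_transposition_graph
    by (intro pair_digraph.pair_wf_digraph pair_graph.axioms(1) pair_graph_star_transposition_graph)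
  moreover have "induced_embedding (\<lambda>v. v @ s) (star_graph l j) (star_graph l k)"
    using induced_embedding_append[of s]
    by (simp add: star_graph_eq_star_transposition_graph split s)
  ultimately show ?thesis
    by (intro induced_embedding_imp_iso_induced_subgraph)
qed

lemma E_chain_star_graph:
  assumes "0 \<notin> K"
  shows "E_chain l K (\<lambda>k. with_proj (star_graph l k))"
  unfolding E_chain_def
proof (intro conjI ballI impI)
  fix k
  assume "k \<in> K"
  show "graph (with_proj (star_graph l k))"
    unfolding star_graph_eq_star_transposition_graph
    using pair_graph_star_transposition_graph by (rule pair_graph.pair_graphD_graph)
  have "0 < k"
    using \<open>k \<in> K\<close> assms by (metis gr0I)
  then show "\<exists>S. E_set l (with_proj (star_graph l k)) S"
    using E_set_first_entry_set by blast
next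
  fix j k :: nat
  assume "j < k"
  then show "\<exists>H. induced_subgraph H (with_proj (star_graph l k)) \<and>
      digraph_iso (with_proj (star_graph l j)) H"
    by (intro star_graph_iso_induced_subgraph) simp
qed

theorem theorem1:
  fixes l :: nat
  assumes "l \<ge> 1"
  shows "(\<forall>k\<ge>2. (l, k) \<noteq> (1, 2) \<longrightarrow>
            (\<forall>i<k. E_set l (with_proj (star_graph l k)) (first_entry_set l k i))) \<and>
         E_chain l {k. k \<ge> 2 \<and> (l, k) \<noteq> (1, 2)} (\<lambda>k. with_proj (star_graph l k))"
proof
  show "\<forall>k\<ge>2. (l, k) \<noteq> (1, 2) \<longrightarrow>
      (\<forall>i<k. E_set l (with_proj (star_graph l k)) (first_entry_set l k i))"
    by (simp add: E_set_first_entry_set)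
  show "E_chain l {k. k \<ge> 2 \<and> (l, k) \<noteq> (1, 2)} (\<lambda>k. with_proj (star_graph l k))"
    by (rule E_chain_star_graph) simp
qed

end
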